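(* There is a constant $C>0$ such that for every integer $n\ge 1$ there is a deterministic fire-and-forward protocol which, for every rooted tree with $n$ nodes (edges directed towards the root) and every assignment of distinct labels from $\{0,1,\dots,n-1\}$ to its nodes, delivers all rumors to the root within at most $Cn^{1.5}$ steps.
   Context: Model. The network is a rooted tree $\mathcal{T}$ with $n$ nodes and root $r$, all edges directed from child to parent. Nodes carry distinct labels from $[n]=\{0,1,\dots,n-1\}$. Each node $v$ initially holds a rumor $\rho_v$. Time is discrete, with steps $0,1,2,\dots$, and all nodes start at step $0$. If $v$ transmits at step $t$, the message is sent immediately to its parent $u$, and $u$ receives it at step $t$ if and only if no other child of $u$ transmits at step $t$ (otherwise a collision occurs, nothing is received, and nobody is informed of the collision). In this fire-and-forward model a node is allowed to receive and transmit in the same step. A deterministic protocol determines the action of each node $v$ at each step $t$ as a function only of $n$, the label of $v$, the time $t$, and the messages received by $v$ before step $t$; it knows neither the tree nor the assignment of labels. Fire-and-forward protocol: at any step $t$, a node $v$ is either idle or makes one of two types of transmission: it fires, i.e. transmits its own rumor $\rho_v$; or it forwards, i.e. transmits the rumor it received in step $t-1$ (if any). A received rumor that is not forwarded in the next step is dropped (a node may drop a received rumor even if it does not fire). If a node attempts to fire at step $t$ right after receiving a rumor at step $t-1$, this counts as a collision and nothing is transmitted. *)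

theory Defs
  imports Complex_Main
begin

text \<open>
  A finite tree on node set \<open>V\<close> with root \<open>r\<close>; \<open>(v, u) \<in> E\<close> means that \<open>u\<close> is the parent of \<open>v\<close>.
\<close>

definition rooted_tree :: "nat set \<Rightarrow> (nat \<times> nat) set \<Rightarrow> nat \<Rightarrow> bool" where
  "rooted_tree V E r \<longleftrightarrow>
     finite V \<and> r \<in> V \<and> E \<subseteq> V \<times> V \<and>
     (\<forall>u. (r, u) \<notin> E) \<and>
     (\<forall>v\<in>V - {r}. \<exists>!u. (v, u) \<in> E) \<and>
     (\<forall>v\<in>V. (v, r) \<in> E\<^sup>*)"

datatype action = Idle | Fire | Forward

text \<open>
  \<open>P l t h\<close> is the action at step \<open>t\<close> of a node with label \<open>l\<close>, where \<open>h\<close> is the list of length \<open>t\<close>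
  whose entry at position \<open>s < t\<close> is the content of the message received at step \<open>s\<close>, or \<open>None\<close>.
  A protocol is chosen for a given \<open>n\<close>, so \<open>n\<close> is not an argument.
\<close>

type_synonym 'm protocol = "nat \<Rightarrow> nat \<Rightarrow> 'm option list \<Rightarrow> action"

text \<open>
  In an execution, a rumor is represented by the node at which it originates. This only serves to
  say which rumor is where: the protocol sees the contents \<open>\<rho> v\<close> of a received rumor \<open>v\<close>, not its
  origin, and different nodes may hold rumors with equal contents.
\<close>

definition last_received :: "'a option list \<Rightarrow> 'a option" where
  "last_received h = (if h = [] then None else last h)"

definition transmits ::
  "'m protocol \<Rightarrow> (nat \<Rightarrow> nat) \<Rightarrow> (nat \<Rightarrow> 'm) \<Rightarrow> nat \<Rightarrow> nat option list \<Rightarrow> nat \<Rightarrow> nat option" where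
  "transmits P lab \<rho> t h v =
     (case P (lab v) t (map (map_option \<rho>) h) of
        Idle \<Rightarrow> None
      | Fire \<Rightarrow> (if last_received h = None then Some v else None)
      | Forward \<Rightarrow> last_received h)"

definition hears :: "(nat \<times> nat) set \<Rightarrow> (nat \<Rightarrow> nat option) \<Rightarrow> nat \<Rightarrow> nat option" where
  "hears E tx u =
     (if \<exists>!v. (v, u) \<in> E \<and> tx v \<noteq> None
      then tx (THE v. (v, u) \<in> E \<and> tx v \<noteq> None)
      else None)"

text \<open>\<open>history P E lab \<rho> t u\<close> lists what \<open>u\<close> received at steps \<open>0, \<dots>, t - 1\<close>.\<close>

primrec history ::
  "'m protocol \<Rightarrow> (nat \<times> nat) set \<Rightarrow> (nat \<Rightarrow> nat) \<Rightarrow> (nat \<Rightarrow> 'm) \<Rightarrow> nat \<Rightarrow> nat \<Rightarrow> nat option list" where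
  "history P E lab \<rho> 0 = (\<lambda>u. [])"
| "history P E lab \<rho> (Suc t) =
     (\<lambda>u. history P E lab \<rho> t u @
        [hears E (\<lambda>v. transmits P lab \<rho> t (history P E lab \<rho> t v) v) u])"

text \<open>The root holds its own rumor from the start.\<close>

definition delivers_all ::
  "'m protocol \<Rightarrow> nat set \<Rightarrow> (nat \<times> nat) set \<Rightarrow> nat \<Rightarrow> (nat \<Rightarrow> nat) \<Rightarrow> (nat \<Rightarrow> 'm) \<Rightarrow> nat \<Rightarrow> bool" where
  "delivers_all P V E r lab \<rho> T \<longleftrightarrow>
     (\<forall>v\<in>V - {r}. Some v \<in> set (history P E lab \<rho> T r))"

end

theory Submission
  imports Defs "HOL-Computational_Algebra.Primes" "HOL-Real_Asymp.Real_Asymp"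
begin

text \<open>
  The protocol is oblivious: every received rumor is forwarded, and a node's firing times depend
  only on its label. A rumor fired at step \<open>s\<close> at depth \<open>d\<close> can only collide with rumors that have
  the same sum \<open>s + d\<close>. Take a prime \<open>p\<close> of order \<open>\<surd>n\<close> and split the labels into about \<open>\<surd>n\<close>
  groups of size \<open>p\<close>. Each group gets its own window of length \<open>2 p\<^sup>2 + n\<close>, so that different groups
  never interfere. Inside a window, the node with residue \<open>r\<close> fires at the \<open>p\<close> times
  \<open>2 p a + (r a mod p)\<close> for \<open>a < p\<close>. Whatever the depths are, another node of the group can spoil at
  most one of these, and there are fewer than \<open>p\<close> other nodes, so one firing gets through.
\<close>

subsection \<open>Primes in \<open>[m, C m]\<close>\<close>

text \<open>
  The numbers \<open>1 / ((n + 1) (n choose k))\<close> form Leibniz' harmonic triangle: by the recurrence used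
  below, they are integer combinations of \<open>1, 1/2, \<dots>, 1/(n + 1)\<close>.
\<close>
lemma Suc_times_binomial_dvd:
  fixes L :: nat
  assumes "k \<le> n" and "\<And>i. 1 \<le> i \<Longrightarrow> i \<le> Suc n \<Longrightarrow> i dvd L"
  shows "Suc n * (n choose k) dvd L"
  using assms
proof (induction k arbitrary: n)
  case 0
  then show ?case by simp
next
  case (Suc k)
  then obtain m where n: "n = Suc m" and km: "k \<le> m"
    by (cases n) auto
  let ?F = "\<lambda>n k. real (Suc n * (n choose k))"
  have "Suc m * (m choose k) dvd L" "Suc n * (n choose k) dvd L"
    using Suc.IH[of m] Suc.IH[of n] Suc.prems n km by auto
  then obtain c d where c: "L = Suc m * (m choose k) * c" and d: "L = Suc n * (n choose k) * d"
    by (elim dvdE)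
  have id: "1 / ?F n (Suc k) = 1 / ?F m k - 1 / ?F n k"
  proof -
    have F: "?F n k = fact (Suc n) / (fact k * fact (n - k))" if "k \<le> n" for n k
      unfolding of_nat_mult binomial_fact[OF that] by simp
    have "Suc m - k = Suc (m - k)" using km by simp
    then have "fact (Suc m - k) = fact (m - k) * (real m + 1 - real k)"
      using km by (simp add: of_nat_diff mult.commute)
    then have b: "?F m k = fact (Suc m) / (fact k * fact (m - k))"
      "?F n k = fact (Suc (Suc m)) / (fact k * (fact (m - k) * (real m + 1 - real k)))"
      "?F n (Suc k) = fact (Suc (Suc m)) / (fact k * (real k + 1) * fact (m - k))"
      using F[of k m] F[of k n] F[of "Suc k" n] km n
      by (simp_all only: diff_Suc_Suc Suc_le_mono le_SucI) (simp add: algebra_simps)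
    have "fact (Suc (Suc m)) = fact (Suc m) * (real m + 2)" by (simp add: algebra_simps)
    then show ?thesis
      unfolding b by (simp add: divide_simps del: fact_Suc) (simp add: algebra_simps)
  qed
  have pos: "?F m k > 0" "?F n k > 0" "?F n (Suc k) > 0"
    using km n Suc.prems(1) by (simp_all only: of_nat_0_less_iff zero_less_binomial_iff nat_0_less_mult_iff) auto
  have "real L / ?F n (Suc k) = real L / ?F m k - real L / ?F n k"
    using arg_cong[OF id, of "\<lambda>x. real L * x"] by (simp add: algebra_simps)
  also have "real L / ?F m k = real c"
    using pos(1) arg_cong[OF c, of real] by (metis of_nat_mult nonzero_mult_div_cancel_left less_irrefl)
  also have "real L / ?F n k = real d"
    using pos(2) arg_cong[OF d, of real] by (metis of_nat_mult nonzero_mult_div_cancel_left less_irrefl)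
  finally have "real L = ?F n (Suc k) * (real c - real d)"
    using pos(3) by (simp add: field_simps)
  \<comment> \<open>The reals were needed for the quotients; the integers are needed for
    \<open>c - d\<close>, since natural subtraction would truncate.\<close>
  then have "real_of_int (int L) = real_of_int (int (Suc n * (n choose Suc k)) * (int c - int d))"
    by simp
  then have "int L = int (Suc n * (n choose Suc k)) * (int c - int d)"
    by (simp only: of_int_eq_iff)
  then show ?case
    by (metis dvd_triv_left of_nat_dvd_iff)
qed

text \<open>Erdos' induction. For \<open>n = 2 * m + 1\<close>, every prime in (m + 1, n] divides
  \<open>n choose m\<close>, which is at most \<open>4 ^ m\<close>; the primes up to
  \<open>m + 1\<close> are covered by the induction hypothesis. An even \<open>n > 2\<close> is not
  prime and contributes nothing new.\<close>

lemma prod_primes_le_four_power: "\<Prod>{p::nat. prime p \<and> p \<le> n} \<le> 4 ^ n"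
proof (induction n rule: less_induct)
  case (less n)
  have fin: "finite {p::nat. prime p \<and> p \<le> k}" for k
    by (rule finite_subset[of _ "{..k}"]) auto
  consider "n \<le> 2" | "n > 2" "even n" | m where "n = 2 * m + 1" "m \<ge> 1"
    by (metis One_nat_def Suc_leI leI less_numeral_extra(3) neq0_conv oddE add.left_neutral
        mult_zero_right one_le_numeral)
  then show ?case
  proof cases
    case 1
    then have "n = 0 \<or> n = 1 \<or> n = 2" by auto
    moreover have "{p::nat. prime p \<and> p \<le> 0} = {}" "{p::nat. prime p \<and> p \<le> 1} = {}"
      by (auto dest: prime_gt_1_nat)
    moreover have "{p::nat. prime p \<and> p \<le> 2} = {2}"
      by (auto dest: prime_ge_2_nat intro: antisym)
    ultimately show ?thesis by (elim disjE) (simp_all only: prod.empty, simp_all)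
  next
    case 2
    then have "\<not> prime n" using primes_dvd_imp_eq two_is_prime_nat by blast
    then have "{p. prime p \<and> p \<le> n} = {p. prime p \<and> p \<le> n - 1}"
      using 2 by (auto simp: le_diff_conv2) (metis One_nat_def Suc_leI Suc_pred le_less less_Suc_eq_le not_gr_zero not_less_zero)
    then have "\<Prod>{p. prime p \<and> p \<le> n} \<le> 4 ^ (n - 1)"
      using less.IH[of "n - 1"] 2 by simp
    also have "\<dots> \<le> 4 ^ n" by (rule power_increasing) auto
    finally show ?thesis .
  next
    case (3 m)
    let ?A = "{p. prime p \<and> p \<le> m + 1}" and ?B = "{p. prime p \<and> m + 1 < p \<and> p \<le> n}"
    have fB: "finite ?B" by (rule finite_subset[OF _ fin[of n]]) auto
    have "\<Prod>?B dvd n choose m"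
    proof (cases "?B = {}")
      case False
      have "Lcm ?B dvd n choose m"
      proof (rule Lcm_least)
        fix p assume p: "p \<in> ?B"
        have "fact m * fact (n - m) * (n choose m) = fact n"
          using 3 by (intro binomial_fact_lemma) auto
        moreover have "p dvd fact n" using p by (simp add: prime_dvd_fact_iff)
        moreover have "\<not> p dvd fact m" "\<not> p dvd fact (n - m)"
          using p 3 by (auto simp: prime_dvd_fact_iff simp del: fact_Suc)
        ultimately show "p dvd n choose m" using p by (metis mem_Collect_eq prime_dvd_mult_iff)
      qed
      moreover have "Lcm ?B = \<Prod>?B"
        using Lcm_coprime[OF fB False] by (simp add: primes_coprime)
      ultimately show ?thesis by simp
    next
      case True
      then show ?thesis by (metis prod.empty one_dvd)
    qed
    moreover have "n choose m \<le> 4 ^ m"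
    proof -
      \<comment> \<open>By symmetry of row \<open>n = 2 * m + 1\<close>, its first
        \<open>m + 1\<close> entries sum to half of \<open>2 ^ n\<close>.\<close>
      have "n choose m \<le> (\<Sum>k\<le>m. n choose k)"
        by (rule member_le_sum) auto
      also have "\<dots> = 2 ^ (2 * m)" using binomial_r_part_sum[of m] 3 by simp
      finally show ?thesis by (simp add: power_mult)
    qed
    moreover have "n choose m > 0" using 3 by simp
    ultimately have B: "\<Prod>?B \<le> 4 ^ m" by (meson dvd_imp_le le_trans)
    have "{p. prime p \<and> p \<le> n} = ?A \<union> ?B" using 3 by auto
    then have "\<Prod>{p. prime p \<and> p \<le> n} = \<Prod>?A * \<Prod>?B"
      using fin fB by (simp only:) (rule prod.union_disjoint, auto)
    also have "\<dots> \<le> 4 ^ (m + 1) * 4 ^ m"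
      using less.IH[of "m + 1"] 3 B by (intro mult_le_mono) auto
    also have "\<dots> = 4 ^ n" using 3 by (simp add: power_add mult_2)
    finally show ?thesis .
  qed
qed

text \<open>The multiplicity of \<open>p\<close> in an lcm is the maximum over the entries, so a
  power of \<open>p\<close> dividing the lcm already divides a single entry. The disjunct
  \<open>e = 0\<close> below covers the empty set, whose \<open>Lcm\<close> is 1.\<close>

lemma prime_power_dvd_Lcm_le:
  fixes p :: nat
  assumes "prime p" "p ^ e dvd Lcm {1..M}" "M \<ge> 1"
  shows "p ^ e \<le> M"
proof -
  have "e = 0 \<or> (\<exists>i\<in>A. p ^ e dvd i)" if "finite A" "0 \<notin> A" "p ^ e dvd Lcm A" for A
    using that
  proof (induction A rule: finite_induct)
    case empty
    then show ?case using assms(1) by (metis Lcm_empty is_unit_power_iff not_prime_unit)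
  next
    case (insert x A)
    have "x \<noteq> 0" "Lcm A \<noteq> 0" using insert by (auto simp: Lcm_0_iff)
    then have "multiplicity p (lcm x (Lcm A)) = max (multiplicity p x) (multiplicity p (Lcm A))"
      using assms(1) by (intro multiplicity_lcm) auto
    moreover have "\<not> is_unit p" using assms(1) not_prime_unit by blast
    ultimately have "p ^ e dvd x \<or> p ^ e dvd Lcm A"
      using insert.prems \<open>x \<noteq> 0\<close> \<open>Lcm A \<noteq> 0\<close>
      by (auto simp: power_dvd_iff_le_multiplicity max_def lcm_eq_0_iff split: if_splits)
    then show ?case using insert by auto
  qed
  from this[of "{1..M}"] assms show ?thesis
    by (auto dest!: dvd_imp_le)
qed

text \<open>The prime factors are split at the square root of \<open>M\<close>. There are at most
  \<open>sqrt M\<close> small ones, each contributing a prime power of size at most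
  \<open>M\<close>. The large ones occur to the first power only and are at most \<open>m\<close>,
  so their product is bounded by the product of all primes up to \<open>m\<close>.\<close>

lemma Lcm_le_if_no_large_primes:
  assumes "\<And>p. prime p \<Longrightarrow> p \<le> M \<Longrightarrow> p \<le> m" and "M \<ge> 1"
  shows "real (Lcm {1..M}) \<le> real M powr sqrt (real M) * 4 ^ m"
proof -
  let ?L = "Lcm {1..M}" and ?s = "nat \<lfloor>sqrt (real M)\<rfloor>"
  have L0: "?L \<noteq> 0" by (simp add: Lcm_0_iff)
  let ?P = "prime_factors ?L"
  let ?A = "{p\<in>?P. p * p \<le> M}" and ?B = "{p\<in>?P. \<not> p * p \<le> M}"
  have le: "p ^ multiplicity p ?L \<le> M" if "p \<in> ?P" for p
    using that assms(2) by (intro prime_power_dvd_Lcm_le) (auto simp: multiplicity_dvd)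
  have mult1: "multiplicity p ?L \<ge> 1" if "p \<in> ?P" for p
    using that by (simp add: prime_factors_multiplicity)
  have "?L = (\<Prod>p\<in>?P. p ^ multiplicity p ?L)"
    using L0 by (simp add: prod_prime_factors)
  also have "\<dots> = (\<Prod>p\<in>?A \<union> ?B. p ^ multiplicity p ?L)"
    by (rule prod.cong) auto
  also have "\<dots> = (\<Prod>p\<in>?A. p ^ multiplicity p ?L) * (\<Prod>p\<in>?B. p ^ multiplicity p ?L)"
    by (rule prod.union_disjoint) auto
  also have "\<dots> \<le> M ^ ?s * 4 ^ m"
  proof (rule mult_le_mono)
    have "(\<Prod>p\<in>?A. p ^ multiplicity p ?L) \<le> (\<Prod>p\<in>?A. M)"
      using le by (intro prod_mono) auto
    also have "\<dots> = M ^ card ?A" by simp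
    also have "\<dots> \<le> M ^ ?s"
    proof (rule power_increasing)
      have "?A \<subseteq> {1..?s}"
      proof
        fix p assume p: "p \<in> ?A"
        then have "real p * real p \<le> real M" by (metis (no_types, lifting) mem_Collect_eq of_nat_le_iff of_nat_mult)
        then have "real p \<le> sqrt (real M)" by (simp add: real_le_rsqrt power2_eq_square)
        then have "p \<le> ?s" by linarith
        moreover have "p \<ge> 1" using p by (metis (no_types, lifting) mem_Collect_eq in_prime_factors_imp_prime prime_ge_1_nat)
        ultimately show "p \<in> {1..?s}" by simp
      qed
      then show "card ?A \<le> ?s" using card_mono[of "{1..?s}" ?A] by simp
    qed (use assms in simp)
    finally show "(\<Prod>p\<in>?A. p ^ multiplicity p ?L) \<le> M ^ ?s" .
    have "(\<Prod>p\<in>?B. p ^ multiplicity p ?L) = \<Prod>?B"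
    proof (rule prod.cong[OF refl])
      fix p assume p: "p \<in> ?B"
      then have "p > 1" by (metis (no_types, lifting) mem_Collect_eq in_prime_factors_imp_prime prime_gt_1_nat)
      have "\<not> multiplicity p ?L \<ge> 2"
      proof
        assume "multiplicity p ?L \<ge> 2"
        then have "p ^ 2 \<le> p ^ multiplicity p ?L" using \<open>p > 1\<close> by (intro power_increasing) auto
        then show False using le[of p] p by (simp add: power2_eq_square)
      qed
      then have "multiplicity p ?L = 1" using mult1[of p] p by auto
      then show "p ^ multiplicity p ?L = p" by simp
    qed
    also have "\<dots> \<le> \<Prod>{p. prime p \<and> p \<le> m}"
    proof (rule dvd_imp_le[OF prod_dvd_prod_subset])
      show fin: "finite {p. prime p \<and> p \<le> m}" by (rule finite_subset[of _ "{..m}"]) auto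
      show "?B \<subseteq> {p. prime p \<and> p \<le> m}"
      proof
        fix p assume p: "p \<in> ?B"
        then have pr: "prime p" by auto
        have "p dvd ?L" using p by auto
        then have "p \<le> M" using prime_power_dvd_Lcm_le[OF pr, of 1 M] assms(2) by simp
        then show "p \<in> {p. prime p \<and> p \<le> m}" using assms(1) pr by simp
      qed
      show "0 < \<Prod>{p. prime p \<and> p \<le> m}" by (intro prod_pos) (auto simp: prime_gt_0_nat)
    qed
    also have "\<dots> \<le> 4 ^ m" by (rule prod_primes_le_four_power)
    finally show "(\<Prod>p\<in>?B. p ^ multiplicity p ?L) \<le> 4 ^ m" .
  qed
  finally have "real ?L \<le> real (M ^ ?s * 4 ^ m)" by (simp only: of_nat_le_iff)
  also have "\<dots> = real M powr real ?s * 4 ^ m"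
    using assms(2) powr_realpow[of "real M" ?s] by simp
  also have "\<dots> \<le> real M powr sqrt (real M) * 4 ^ m"
    using assms(2) by (intro mult_right_mono powr_mono) auto
  finally show ?thesis .
qed

text \<open>Without such a prime, \<open>Lcm {1..4*m+1}\<close> would be below
  \<open>4 ^ m * 4 ^ m\<close> for large \<open>m\<close>. But it is a multiple of
  \<open>4*m+1\<close> times the central binomial coefficient of row \<open>4*m\<close>, and this
  product is at least \<open>4 ^ (2*m)\<close>.\<close>

lemma eventually_prime_between:
  "eventually (\<lambda>m::nat. \<exists>p. prime p \<and> m \<le> p \<and> p \<le> 4 * m + 1) at_top"
proof -
  have ln4: "ln (4::real) \<ge> 1"
    using exp_le ln_ge_iff[of 4 1] by simp
  \<comment> \<open>Since \<open>ln 4\<close> is at least 1, this is a sufficient logarithmic form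
    of \<open>(4*m+1) powr sqrt (4*m+1) < 4 ^ m\<close>.\<close>
  have "eventually (\<lambda>m::nat. sqrt (4 * real m + 1) * ln (4 * real m + 1) < real m) at_top"
    by real_asymp
  then show ?thesis
    using eventually_ge_at_top[of 1]
  proof eventually_elim
    case (elim m)
    show ?case
    proof (rule ccontr)
      assume no: "\<not> ?thesis"
      let ?M = "4 * m + 1"
      have "sqrt (real ?M) * ln (real ?M) < real m"
        using elim by (simp add: add.commute)
      also have "\<dots> \<le> real m * ln 4" using ln4 mult_left_mono[of 1 "ln 4" "real m"] by simp
      finally have "real ?M powr sqrt (real ?M) < 4 powr real m"
        unfolding powr_def by simp
      then have small: "real ?M powr sqrt (real ?M) < 4 ^ m" by (simp add: powr_realpow)
      have "4 ^ (2 * m) / (2 * real (2 * m)) \<le> real ((2 * (2 * m)) choose (2 * m))"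
        using elim by (intro central_binomial_lower_bound) auto
      then have "4 ^ (2 * m) \<le> real (2 * (2 * m)) * real ((2 * (2 * m)) choose (2 * m))"
        using elim by (simp add: field_simps)
      also have "\<dots> \<le> real (Suc (2 * (2 * m)) * ((2 * (2 * m)) choose (2 * m)))"
        unfolding of_nat_mult by (intro mult_right_mono) auto
      also have "\<dots> \<le> real (Lcm {1..?M})"
      proof -
        have "Suc (2 * (2 * m)) * ((2 * (2 * m)) choose (2 * m)) dvd Lcm {1..?M}"
          by (rule Suc_times_binomial_dvd) (auto intro!: dvd_Lcm)
        moreover have "Lcm {1..?M} > 0" by (intro Nat.gr0I) (simp add: Lcm_0_iff)
        ultimately show ?thesis by (simp only: of_nat_le_iff dvd_imp_le)
      qed
      also have "\<dots> \<le> real ?M powr sqrt (real ?M) * 4 ^ m"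
      proof (rule Lcm_le_if_no_large_primes)
        show "p \<le> m" if "prime p" "p \<le> ?M" for p
          using no that nat_le_linear by blast
      qed simp
      also have "\<dots> < 4 ^ m * 4 ^ m"
        using small by (intro mult_strict_right_mono) auto
      finally show False by (simp add: mult_2 power_add)
    qed
  qed
qed

text \<open>One fixed prime \<open>q > N\<close> serves all \<open>m\<close> below the threshold
  \<open>N\<close>. The factor \<open>q + 5\<close> covers both this \<open>q\<close> and the bound
  \<open>4 * m + 1\<close>, which is at most \<open>5 * m\<close>.\<close>

lemma prime_between_multiple:
  "\<exists>C::nat. \<forall>m\<ge>1. \<exists>p. prime p \<and> m \<le> p \<and> p \<le> C * m"
proof -
  obtain N where N: "\<And>m. m \<ge> N \<Longrightarrow> \<exists>p::nat. prime p \<and> m \<le> p \<and> p \<le> 4 * m + 1"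
    using eventually_prime_between unfolding eventually_sequentially by blast
  obtain q where q: "prime q" "q > N" using bigger_prime by blast
  have "\<exists>p. prime p \<and> m \<le> p \<and> p \<le> (q + 5) * m" if "m \<ge> 1" for m
  proof (cases "m \<ge> N")
    case True
    then obtain p where p: "prime p" "m \<le> p" "p \<le> 4 * m + 1" using N by blast
    have "4 * m + 1 \<le> (q + 5) * m" using that by (simp add: algebra_simps)
    then show ?thesis using p by (meson le_trans)
  next
    case False
    have "q * 1 \<le> (q + 5) * m" using that by (intro mult_le_mono) auto
    then show ?thesis using False q by (intro exI[of _ q]) auto
  qed
  then show ?thesis by blast
qed

subsection \<open>Firing times\<close>

text \<open>\<open>D\<close> and \<open>D'\<close> stand for the depths of two nodes of one group
  with residues \<open>r\<close> and \<open>r'\<close>. Subtracting the two coincidences eliminates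
  the depths. What remains forces both nodes to shift their firing index by the same
  \<open>x\<close>, and then \<open>p\<close> divides \<open>(r - r') * x\<close>.\<close>

lemma firing_coincidence_unique:
  fixes p r r' a a' b b' D D' :: int
  assumes p: "prime p" and r: "0 \<le> r" "r < p" "0 \<le> r'" "r' < p" "r \<noteq> r'"
    and a: "0 \<le> a" "a < p" "0 \<le> a'" "a' < p"
    and e: "2 * p * a + (r * a) mod p + D = 2 * p * b + (r' * b) mod p + D'"
    and e': "2 * p * a' + (r * a') mod p + D = 2 * p * b' + (r' * b') mod p + D'"
  shows "a = a'"
proof -
  let ?u = "(r * a) mod p" and ?u' = "(r * a') mod p" and ?w = "(r' * b) mod p" and ?w' = "(r' * b') mod p"
  have p0: "p > 0" using p prime_gt_0_int by blast
  have bds: "0 \<le> ?u" "?u < p" "0 \<le> ?u'" "?u' < p" "0 \<le> ?w" "?w < p" "0 \<le> ?w'" "?w' < p"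
    using p0 by auto
  define x where "x = a - a'"
  define z where "z = x - (b - b')"
  have z: "2 * p * z = (?w - ?w') - (?u - ?u')"
    using e e' unfolding z_def x_def by (simp add: algebra_simps)
  \<comment> \<open>Differences of residues are smaller than \<open>2 p\<close>; this is what the factor 2 in the step is for.\<close>
  have "z = 0"
  proof (rule ccontr)
    assume "z \<noteq> 0"
    then have "1 \<le> \<bar>z\<bar>" by simp
    then have "2 * p * 1 \<le> 2 * p * \<bar>z\<bar>" using p0 by (intro mult_left_mono) auto
    then have "2 * p \<le> \<bar>2 * p * z\<bar>" using p0 by (simp add: abs_mult)
    then show False using bds unfolding z by linarith
  qed
  then have uw: "?u - ?u' = ?w - ?w'" and bx: "b - b' = x" using z unfolding z_def by simp_all
  have "(r * a - r * a') mod p = (r' * b - r' * b') mod p"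
    using arg_cong[OF uw, of "\<lambda>y. y mod p"] by (simp add: mod_diff_eq)
  then have "p dvd (r * a - r * a') - (r' * b - r' * b')" by (rule mod_eq_dvd_iff[THEN iffD1])
  also have "(r * a - r * a') - (r' * b - r' * b') = (r - r') * x"
  proof -
    have "b' = b - x" "a' = a - x" using bx unfolding x_def by simp_all
    then show ?thesis by (simp only:) (simp add: algebra_simps)
  qed
  finally have "p dvd r - r' \<or> p dvd x" using p prime_dvd_mult_iff by blast
  moreover have "\<not> p dvd r - r'"
    using r zdvd_not_zless[of "\<bar>r - r'\<bar>" p] by auto
  ultimately have "p dvd x" by simp
  moreover have "\<bar>x\<bar> < p" using a unfolding x_def by linarith
  ultimately have "x = 0" using dvd_imp_le_int[of x p] by linarith
  then show ?thesis unfolding x_def by simp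
qed

text \<open>For \<open>a < p\<close> the offset inside a window stays below \<open>2 * p^2\<close>.
  The further \<open>n\<close> steps leave room for adding a depth, so that time plus depth does not
  run into the next window.\<close>

definition slot :: "nat \<Rightarrow> nat \<Rightarrow> nat \<Rightarrow> nat \<Rightarrow> nat" where
  "slot n p l a = (l div p) * (2 * p\<^sup>2 + n) + 2 * p * a + ((l mod p) * a) mod p"

lemma slot_offset_less:
  fixes a p r :: nat
  assumes "a < p"
  shows "2 * p * a + (r * a) mod p < 2 * p\<^sup>2"
proof -
  have "2 * p * (a + 1) \<le> 2 * p * p" using assms by (intro mult_le_mono) auto
  moreover have "(r * a) mod p < p" using assms by simp
  ultimately show ?thesis unfolding power2_eq_square by (simp add: algebra_simps)
qed

lemma slot_bounds:
  assumes "a < p" "d < n"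
  shows "(2 * p\<^sup>2 + n) * (l div p) \<le> slot n p l a + d"
    and "slot n p l a + d < (2 * p\<^sup>2 + n) * Suc (l div p)"
  using slot_offset_less[OF assms(1), of "l mod p"] assms(2)
  unfolding slot_def by (simp_all add: algebra_simps)

text \<open>The sum of firing time and depth thus reveals the group, so equal sums can occur only
  within one group.\<close>

lemma slot_div:
  assumes "a < p" "d < n"
  shows "(slot n p l a + d) div (2 * p\<^sup>2 + n) = l div p"
  using slot_bounds[OF assms] by (intro div_nat_eqI) simp_all

text \<open>Pigeonhole: if every firing of \<open>w\<close> were spoiled, the \<open>p\<close>
  spoilers would have \<open>p\<close> distinct residues, all different from that of
  \<open>w\<close>.\<close>

lemma collision_free_slot:
  fixes lab dep :: "'a \<Rightarrow> nat"
  assumes p: "prime p" and inj: "inj_on lab V" and dep: "\<And>v. v \<in> V \<Longrightarrow> dep v < n" and w: "w \<in> V"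
  shows "\<exists>a<p. \<forall>v\<in>V. \<forall>b<p.
    slot n p (lab v) b + dep v = slot n p (lab w) a + dep w \<longrightarrow> v = w"
proof (rule ccontr)
  assume "\<not> ?thesis"
  then have "\<forall>a. \<exists>v b. a < p \<longrightarrow> v \<in> V \<and> v \<noteq> w \<and> b < p \<and>
      slot n p (lab v) b + dep v = slot n p (lab w) a + dep w"
    by blast
  \<comment> \<open>\<open>f a\<close> is a node spoiling the firing \<open>a\<close> of
    \<open>w\<close>, and \<open>g a\<close> is the index of its own firing that does so.\<close>
  then obtain f g where fg: "\<And>a. a < p \<Longrightarrow> f a \<in> V \<and> f a \<noteq> w \<and> g a < p \<and>
      slot n p (lab (f a)) (g a) + dep (f a) = slot n p (lab w) a + dep w"
    by metis
  have p0: "p > 0" using p prime_gt_0_nat by blast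
  have grp: "lab (f a) div p = lab w div p" if "a < p" for a
    using slot_div[of "g a" p "dep (f a)" n "lab (f a)"] slot_div[of a p "dep w" n "lab w"]
      fg[OF that] dep w that by metis
  have same: "v = v'" if "v \<in> V" "v' \<in> V" "lab v div p = lab v' div p" "lab v mod p = lab v' mod p"
    for v v'
    using that inj by (metis div_mult_mod_eq inj_onD)
  let ?r = "\<lambda>v. lab v mod p"
  have eq: "2 * int p * int a + (int (?r w) * int a) mod int p + int (dep w) =
      2 * int p * int (g a) + (int (?r (f a)) * int (g a)) mod int p + int (dep (f a))"
    if "a < p" for a
  proof -
    have "2 * p * a + (?r w * a) mod p + dep w = 2 * p * g a + (?r (f a) * g a) mod p + dep (f a)"
      using fg[OF that] grp[OF that] unfolding slot_def by simp
    then have "int (2 * p * a + (?r w * a) mod p + dep w)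
        = int (2 * p * g a + (?r (f a) * g a) mod p + dep (f a))" by (rule arg_cong)
    then show ?thesis by (simp only: of_nat_add of_nat_mult of_nat_mod of_nat_numeral)
  qed
  have "inj_on (\<lambda>a. ?r (f a)) {..<p}"
  proof (rule inj_onI)
    fix a a' assume aa: "a \<in> {..<p}" "a' \<in> {..<p}" "?r (f a) = ?r (f a')"
    \<comment> \<open>Within a group the residue determines the label, hence the node. One node
      would then spoil both firings \<open>a\<close> and \<open>a'\<close>.\<close>
    then have f: "f a' = f a" using same[of "f a'" "f a"] fg grp by simp
    have r: "?r (f a) \<noteq> ?r w" using same[of "f a" w] fg[of a] grp[of a] w aa by auto
    have "int a = int a'"
    proof (rule firing_coincidence_unique)
      show "prime (int p)" using p by simp
      show "int (?r w) \<noteq> int (?r (f a))" using r by simp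
      show "2 * int p * int a + (int (?r w) * int a) mod int p + int (dep w) =
          2 * int p * int (g a) + (int (?r (f a)) * int (g a)) mod int p + int (dep (f a))"
        using eq aa by blast
      show "2 * int p * int a' + (int (?r w) * int a') mod int p + int (dep w) =
          2 * int p * int (g a') + (int (?r (f a)) * int (g a')) mod int p + int (dep (f a))"
        using eq[of a'] aa unfolding f by blast
    qed (use p0 aa in \<open>simp_all only: lessThan_iff of_nat_less_iff of_nat_0_le_iff mod_less_divisor\<close>)
    then show "a = a'" by simp
  qed
  moreover have "(\<lambda>a. ?r (f a)) ` {..<p} \<subseteq> {..<p} - {?r w}"
    using same[of _ w] fg grp w p0 by auto
  ultimately have "card {..<p} \<le> card ({..<p} - {?r w})"
    by (intro card_inj_on_le) auto
  then show False using p0 by simp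
qed

subsection \<open>Depth in rooted trees\<close>

lemma rooted_tree_parent_unique:
  assumes "rooted_tree V E r" "(v, u) \<in> E" "(v, u') \<in> E"
  shows "u = u'"
  using assms unfolding rooted_tree_def by blast

definition depth :: "(nat \<times> nat) set \<Rightarrow> nat \<Rightarrow> nat \<Rightarrow> nat" where
  "depth E r v = (LEAST k. (v, r) \<in> E ^^ k)"

lemma depth_relpow:
  assumes "rooted_tree V E r" "v \<in> V"
  shows "(v, r) \<in> E ^^ depth E r v"
proof -
  have "\<exists>k. (v, r) \<in> E ^^ k"
    using assms unfolding rooted_tree_def by (simp add: rtrancl_power)
  then show ?thesis unfolding depth_def by (rule LeastI_ex)
qed

lemma depth_root: "depth E r r = 0"
  unfolding depth_def by (rule Least_equality) auto

text \<open>One inequality prepends the edge to a path from \<open>u\<close>. For the other, the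
  first step of a shortest path from \<open>v\<close> must lead to its only parent
  \<open>u\<close>.\<close>

lemma depth_edge:
  assumes T: "rooted_tree V E r" and e: "(v, u) \<in> E"
  shows "depth E r v = Suc (depth E r u)"
proof (rule antisym)
  have V: "v \<in> V" "u \<in> V" and vr: "v \<noteq> r" using T e unfolding rooted_tree_def by auto
  have "(v, r) \<in> E ^^ Suc (depth E r u)"
    using e depth_relpow[OF T V(2)] by (rule relpow_Suc_I2)
  then show "depth E r v \<le> Suc (depth E r u)"
    unfolding depth_def[of E r v] by (rule Least_le)
  have v: "(v, r) \<in> E ^^ depth E r v" by (rule depth_relpow[OF T V(1)])
  with vr obtain k where k: "depth E r v = Suc k" by (cases "depth E r v") auto
  with v obtain u' where "(v, u') \<in> E" "(u', r) \<in> E ^^ k" by (metis relpow_Suc_D2)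
  then have "(u, r) \<in> E ^^ k" using rooted_tree_parent_unique[OF T e] by blast
  then have "depth E r u \<le> k" unfolding depth_def by (rule Least_le)
  then show "Suc (depth E r u) \<le> depth E r v" using k by simp
qed

lemma depth_zero_iff:
  assumes "rooted_tree V E r" "v \<in> V"
  shows "depth E r v = 0 \<longleftrightarrow> v = r"
  using depth_relpow[OF assms] depth_root by (metis relpow_0_E)

lemma depth_ancestor:
  assumes "rooted_tree V E r" "(v, u) \<in> E ^^ k"
  shows "depth E r v = depth E r u + k"
  using assms(2) by (induction k arbitrary: u) (auto dest: depth_edge[OF assms(1)])

text \<open>Climbing from \<open>v\<close> to the root meets every depth from
  \<open>depth E r v\<close> down to 0, so \<open>V\<close> has at least that many nodes plus
  one.\<close>

lemma depth_less_card:
  assumes T: "rooted_tree V E r" and v: "v \<in> V"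
  shows "depth E r v < card V"
proof -
  have "{..depth E r v} \<subseteq> depth E r ` V"
    using v
  proof (induction "depth E r v" arbitrary: v)
    case 0
    then show ?case by auto
  next
    case (Suc k)
    then have "v \<noteq> r" by (metis depth_root nat.distinct(1))
    then obtain u where u: "(v, u) \<in> E" "u \<in> V"
      using T Suc.prems unfolding rooted_tree_def by blast
    have "k = depth E r u" using depth_edge[OF T u(1)] Suc.hyps(2) by simp
    then have "{..k} \<subseteq> depth E r ` V" using Suc.hyps(1) u(2) by blast
    then show ?case using Suc.hyps(2) Suc.prems by (metis atMost_Suc image_eqI insert_subset)
  qed
  moreover have "finite V" using T unfolding rooted_tree_def by simp
  ultimately have "card {..depth E r v} \<le> card V" using surj_card_le by blast
  then show ?thesis by simp
qed

lemma relpow_functional: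
  assumes "rooted_tree V E r" "(w, v) \<in> E ^^ k" "(w, v') \<in> E ^^ k"
  shows "v = v'"
  using assms(2,3)
proof (induction k arbitrary: v v')
  case (Suc k)
  then show ?case using rooted_tree_parent_unique[OF assms(1)] by (metis relpow_Suc_E)
qed simp

subsection \<open>Protocols that forward everything\<close>

lemma hears_SomeD:
  assumes "hears E tx u = Some x"
  shows "\<exists>v. (v, u) \<in> E \<and> tx v = Some x"
proof -
  let ?Q = "\<lambda>v. (v, u) \<in> E \<and> tx v \<noteq> None"
  have ex: "\<exists>!v. ?Q v"
    using assms unfolding hears_def by (rule contrapos_pp) (simp only: if_False option.distinct not_False_eq_True)
  then have "tx (THE v. ?Q v) = Some x"
    using assms unfolding hears_def by (simp only: if_True)
  with theI'[OF ex] show ?thesis by blast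
qed

lemma hears_eqI:
  assumes "(v, u) \<in> E" "tx v = Some x" "\<And>v'. (v', u) \<in> E \<Longrightarrow> tx v' \<noteq> None \<Longrightarrow> v' = v"
  shows "hears E tx u = Some x"
proof -
  let ?Q = "\<lambda>v. (v, u) \<in> E \<and> tx v \<noteq> None"
  have v: "?Q v" using assms(1,2) by simp
  then have "\<exists>!v. ?Q v" by (rule ex1I) (blast intro: assms(3))
  moreover have "(THE v. ?Q v) = v" using v by (rule the_equality) (blast intro: assms(3))
  ultimately show ?thesis using assms(2) unfolding hears_def by (simp only: if_True)
qed

text \<open>\<open>F l\<close> is the set of scheduled firing times of label \<open>l\<close>.
  Forwarding takes precedence, so a scheduled firing right after a reception is skipped and the
  received rumor survives.\<close>

definition relay_protocol :: "(nat \<Rightarrow> nat set) \<Rightarrow> 'm protocol" where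
  "relay_protocol F l t h =
     (if last_received h \<noteq> None then Forward else if t \<in> F l then Fire else Idle)"

text \<open>The contents \<open>\<rho>\<close> drop out: the protocol only tests whether something
  was received.\<close>

lemma transmits_relay:
  "transmits (relay_protocol F) lab \<rho> t h v =
     (case last_received h of Some x \<Rightarrow> Some x | None \<Rightarrow> if t \<in> F (lab v) then Some v else None)"
proof -
  have "last_received (map (map_option \<rho>) h) = map_option \<rho> (last_received h)"
    unfolding last_received_def by (simp add: last_map)
  then show ?thesis
    unfolding transmits_def relay_protocol_def by (auto split: option.split)
qed

definition sends ::
  "'m protocol \<Rightarrow> (nat \<times> nat) set \<Rightarrow> (nat \<Rightarrow> nat) \<Rightarrow> (nat \<Rightarrow> 'm) \<Rightarrow> nat \<Rightarrow> nat \<Rightarrow> nat option" where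
  "sends P E lab \<rho> t v = transmits P lab \<rho> t (history P E lab \<rho> t v) v"

lemma history_Suc: "history P E lab \<rho> (Suc t) u = history P E lab \<rho> t u @ [hears E (sends P E lab \<rho> t) u]"
  by (simp add: sends_def[abs_def])

lemma history_mono:
  "t \<le> t' \<Longrightarrow> set (history P E lab \<rho> t u) \<subseteq> set (history P E lab \<rho> t' u)"
  by (induction t' rule: dec_induct) auto

lemma sends_relay_0:
  "sends (relay_protocol F) E lab \<rho> 0 v = (if 0 \<in> F (lab v) then Some v else None)"
  unfolding sends_def transmits_relay by (simp add: last_received_def)

lemma sends_relay_Suc:
  "sends (relay_protocol F) E lab \<rho> (Suc t) v =
     (case hears E (sends (relay_protocol F) E lab \<rho> t) v of
        Some x \<Rightarrow> Some x | None \<Rightarrow> if Suc t \<in> F (lab v) then Some v else None)"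
  unfolding sends_def[of _ _ _ _ "Suc t"] transmits_relay history_Suc by (simp add: last_received_def)

text \<open>A rumor in transit climbs exactly one edge per step after its firing at
  \<open>s\<close>. Hence time plus depth of the current sender is conserved along its way.\<close>

lemma sends_relay_origin:
  assumes T: "rooted_tree V E r" and "v \<in> V"
    and "sends (relay_protocol F) E lab \<rho> t v = Some x"
  shows "x \<in> V \<and> (\<exists>s k. s \<in> F (lab x) \<and> t = s + k \<and> (x, v) \<in> E ^^ k)"
  using assms(2,3)
proof (induction t arbitrary: v)
  case 0
  then show ?case by (auto simp: sends_relay_0 split: if_splits)
next
  case (Suc t)
  show ?case
  proof (cases "hears E (sends (relay_protocol F) E lab \<rho> t) v")
    case None
    then have "Suc t \<in> F (lab v)" "x = v"
      using Suc.prems by (auto simp: sends_relay_Suc split: if_splits)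
    then show ?thesis using Suc.prems by (intro conjI exI[of _ "Suc t"] exI[of _ 0]) auto
  next
    case (Some y)
    then have "y = x" using Suc.prems by (simp add: sends_relay_Suc)
    then obtain c where c: "(c, v) \<in> E" "sends (relay_protocol F) E lab \<rho> t c = Some x"
      using hears_SomeD Some by metis
    have "c \<in> V" using c T unfolding rooted_tree_def by auto
    from Suc.IH[OF this c(2)] obtain s k
      where *: "x \<in> V" "s \<in> F (lab x)" "t = s + k" "(x, c) \<in> E ^^ k" by blast
    then have "(x, v) \<in> E ^^ Suc k" using c by auto
    then show ?thesis using * by (metis add_Suc_right)
  qed
qed

text \<open>By conservation of time plus depth, whatever is sent at step \<open>s + k\<close> from
  the depth of the ancestor \<open>k\<close> levels above \<open>w\<close> must be the rumor of
  \<open>w\<close>, by \<open>free\<close>. Its sender is then that ancestor itself, so no sibling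
  transmits and the rumor moves on.\<close>

lemma relay_delivers:
  assumes T: "rooted_tree V E r" and w: "w \<in> V" "w \<noteq> r" and s: "s \<in> F (lab w)"
    and free: "\<And>v s'. v \<in> V \<Longrightarrow> s' \<in> F (lab v) \<Longrightarrow>
      s' + depth E r v = s + depth E r w \<Longrightarrow> v = w"
    and t: "s + depth E r w \<le> t"
  shows "Some w \<in> set (history (relay_protocol F) E lab \<rho> t r)"
proof -
  let ?tx = "sends (relay_protocol F) E lab \<rho>"
  have only_w: "x = w" "(w, v') \<in> E ^^ k"
    if wv: "(w, v) \<in> E ^^ k" and v': "v' \<in> V" "depth E r v' = depth E r v"
      and x: "?tx (s + k) v' = Some x" for v v' k x
  proof -
    obtain s' k' where o: "x \<in> V" "s' \<in> F (lab x)" "s + k = s' + k'" "(x, v') \<in> E ^^ k'"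
      using sends_relay_origin[OF T v'(1) x] by blast
    have d: "depth E r x = depth E r v' + k'" "depth E r w = depth E r v + k"
      using depth_ancestor[OF T o(4)] depth_ancestor[OF T wv] .
    show "x = w" using o(1,2,3) d v'(2) by (intro free[of x s']) auto
    then show "(w, v') \<in> E ^^ k" using o(3,4) d v'(2) by simp
  qed
  have heard: "hears E (?tx (s + k)) u = Some w"
    if wv: "(w, v) \<in> E ^^ k" and v: "?tx (s + k) v = Some w" and vu: "(v, u) \<in> E" for k v u
  proof (rule hears_eqI[OF vu, of "?tx (s + k)", OF v])
    fix v' assume v': "(v', u) \<in> E" "?tx (s + k) v' \<noteq> None"
    then have "v' \<in> V" "depth E r v' = depth E r v"
      using T depth_edge[OF T] vu unfolding rooted_tree_def by auto
    then have "(w, v') \<in> E ^^ k" using only_w(2)[OF wv] v' by blast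
    then show "v' = v" using relpow_functional[OF T _ wv] by blast
  qed
  have travel: "\<exists>v. (w, v) \<in> E ^^ k \<and> v \<in> V \<and> ?tx (s + k) v = Some w" if "k < depth E r w" for k
    using that
  proof (induction k)
    case 0
    \<comment> \<open>At step \<open>s\<close> the node \<open>w\<close> either fires or forwards,
      so it sends something; \<open>only_w\<close> shows that this is its own rumor.\<close>
    have "?tx s w \<noteq> None"
      using s by (cases s) (auto simp: sends_relay_0 sends_relay_Suc split: option.split)
    then show ?case using only_w(1)[of w 0 w] w by auto
  next
    case (Suc k)
    then obtain v where v: "(w, v) \<in> E ^^ k" "v \<in> V" "?tx (s + k) v = Some w" by auto
    have "v \<noteq> r" using depth_ancestor[OF T v(1)] Suc.prems depth_root[of E r] by auto
    then obtain u where u: "(v, u) \<in> E" "u \<in> V" using T v unfolding rooted_tree_def by blast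
    then show ?case using heard[OF v(1,3) u(1)] v(1) by (auto simp: sends_relay_Suc)
  qed
  have "depth E r w \<noteq> 0" using depth_zero_iff[OF T] w by simp
  \<comment> \<open>The last hop is separate: after \<open>k\<close> steps the sender is a child of
    the root. The root hears it at step \<open>s + k\<close>, which enters the history of length
    \<open>Suc (s + k) = s + depth E r w\<close>.\<close>
  then obtain k where k: "depth E r w = Suc k" by (cases "depth E r w") auto
  then obtain v where v: "(w, v) \<in> E ^^ k" "v \<in> V" "?tx (s + k) v = Some w" using travel by auto
  have dv: "depth E r v = 1" using depth_ancestor[OF T v(1)] k by simp
  then have "v \<noteq> r" using depth_root[of E r] by auto
  then obtain u where u: "(v, u) \<in> E" "u \<in> V" using T v unfolding rooted_tree_def by blast
  then have "u = r" using depth_edge[OF T u(1)] dv depth_zero_iff[OF T] by simp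
  then have "Some w \<in> set (history (relay_protocol F) E lab \<rho> (Suc (s + k)) r)"
    using heard[OF v(1,3) u(1)] unfolding history_Suc by simp
  moreover have "Suc (s + k) \<le> t" using t k by simp
  ultimately show ?thesis by (rule history_mono[THEN subsetD, rotated])
qed

subsection \<open>The running time\<close>

text \<open>Labels below \<open>n\<close> lie in groups numbered at most \<open>n div p\<close>, and
  each successful rumor arrives before the window of its group ends. The time bound is the total
  length of these windows.\<close>

lemma relay_slot_delivers_all:
  assumes p: "prime p" and T: "rooted_tree V E r" and n: "card V = n" and inj: "inj_on lab V"
    and lab: "lab ` V \<subseteq> {0..<n}"
  shows "delivers_all (relay_protocol (\<lambda>l. slot n p l ` {..<p})) V E r lab \<rho>
           ((2 * p\<^sup>2 + n) * Suc (n div p))"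
  unfolding delivers_all_def
proof
  fix w assume w: "w \<in> V - {r}"
  have dep: "depth E r v < n" if "v \<in> V" for v
    using depth_less_card[OF T that] n by simp
  obtain a where a: "a < p" and free: "\<forall>v\<in>V. \<forall>b<p.
      slot n p (lab v) b + depth E r v = slot n p (lab w) a + depth E r w \<longrightarrow> v = w"
    using collision_free_slot[OF p inj, where dep = "depth E r" and w = w] dep w by blast
  have dw: "depth E r w < n" using dep w by simp
  have "lab w \<le> n" using lab w by (auto intro: less_imp_le)
  then have "(2 * p\<^sup>2 + n) * Suc (lab w div p) \<le> (2 * p\<^sup>2 + n) * Suc (n div p)"
    by (intro mult_le_mono) (auto intro: div_le_mono)
  then have "slot n p (lab w) a + depth E r w \<le> (2 * p\<^sup>2 + n) * Suc (n div p)"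
    using slot_bounds(2)[OF a dw, of "lab w"] by (meson less_imp_le less_le_trans)
  then show "Some w \<in> set (history (relay_protocol (\<lambda>l. slot n p l ` {..<p})) E lab \<rho>
           ((2 * p\<^sup>2 + n) * Suc (n div p)) r)"
    using w a free by (intro relay_delivers[OF T, where s = "slot n p (lab w) a"]) auto
qed

theorem theorem4:
  shows "\<exists>C::real. C > 0 \<and>
    (\<forall>n::nat. n \<ge> 1 \<longrightarrow>
      (\<exists>P :: 'm protocol.
        \<forall>V E r lab (\<rho> :: nat \<Rightarrow> 'm).
          rooted_tree V E r \<and> card V = n \<and> inj_on lab V \<and> lab ` V \<subseteq> {0..<n} \<longrightarrow>
          (\<exists>T::nat. real T \<le> C * real n powr 1.5 \<and> delivers_all P V E r lab \<rho> T)))"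
proof -
  obtain K :: nat where K: "\<And>m. m \<ge> 1 \<Longrightarrow> \<exists>p. prime p \<and> m \<le> p \<and> p \<le> K * m"
    using prime_between_multiple by blast
  \<comment> \<open>From \<open>p <= 2 * K * sqrt n\<close>, a window has length at most
    \<open>(8 * K^2 + 1) * n\<close>. The factor 2 comes from the number of windows, at most
    \<open>sqrt n + 1 <= 2 * sqrt n\<close>.\<close>
  define C where "C = 2 * (8 * (real K)\<^sup>2 + 1)"
  have "\<exists>P :: 'm protocol. \<forall>V E r lab (\<rho> :: nat \<Rightarrow> 'm).
          rooted_tree V E r \<and> card V = n \<and> inj_on lab V \<and> lab ` V \<subseteq> {0..<n} \<longrightarrow>
          (\<exists>T::nat. real T \<le> C * real n powr 1.5 \<and> delivers_all P V E r lab \<rho> T)"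
    if n: "n \<ge> 1" for n
  proof -
    define x where "x = sqrt (real n)"
    have x1: "x \<ge> 1" and xx: "x * x = real n" using n unfolding x_def by simp_all
    define m where "m = nat \<lceil>x\<rceil>"
    have m: "x \<le> real m" "real m \<le> x + 1" "m \<ge> 1" using x1 unfolding m_def by linarith+
    obtain p where p: "prime p" "m \<le> p" "p \<le> K * m" using K[OF m(3)] by blast
    have px: "x \<le> real p" using m p(2) by (meson of_nat_le_iff order_trans)
    have "real p \<le> real (K * m)" using p(3) by (rule of_nat_mono)
    also have "\<dots> \<le> real K * (2 * x)" unfolding of_nat_mult using m x1 by (intro mult_left_mono) auto
    finally have "(real p)\<^sup>2 \<le> (real K * (2 * x))\<^sup>2" by (intro power_mono) auto
    then have p2: "2 * (real p)\<^sup>2 + real n \<le> (8 * (real K)\<^sup>2 + 1) * real n"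
      unfolding xx[symmetric] by (simp add: power_mult_distrib power2_eq_square algebra_simps)
    have "real (n div p) \<le> real n / real p" by (rule of_nat_div_le_of_nat)
    also have "\<dots> \<le> real n / x" using px x1 by (intro divide_left_mono) auto
    also have "\<dots> = x" using xx x1 by (simp add: field_simps)
    finally have ndp: "real (Suc (n div p)) \<le> 2 * x" using x1 by simp
    have pw: "real n powr 1.5 = real n * x"
      using n powr_add[of "real n" 1 "1/2"] unfolding x_def by (simp add: powr_half_sqrt)
    have "real ((2 * p\<^sup>2 + n) * Suc (n div p)) \<le> ((8 * (real K)\<^sup>2 + 1) * real n) * (2 * x)"
      unfolding of_nat_mult using p2 ndp by (intro mult_mono) auto
    also have "\<dots> = C * real n powr 1.5" unfolding pw C_def by simp
    finally have "real ((2 * p\<^sup>2 + n) * Suc (n div p)) \<le> C * real n powr 1.5" .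
    then have "\<exists>T. real T \<le> C * real n powr 1.5 \<and>
        delivers_all (relay_protocol (\<lambda>l. slot n p l ` {..<p})) V E r lab \<rho> T"
      if "rooted_tree V E r" "card V = n" "inj_on lab V" "lab ` V \<subseteq> {0..<n}"
      for V E r lab and \<rho> :: "nat \<Rightarrow> 'm"
      using relay_slot_delivers_all[OF p(1) that] by blast
    then show ?thesis
      by (intro exI[of _ "relay_protocol (\<lambda>l. slot n p l ` {..<p})"]) simp
  qed
  moreover have "C > 0"
    unfolding C_def by (intro mult_pos_pos add_nonneg_pos) simp_all
  ultimately show ?thesis
    by (intro exI[of _ C] conjI allI impI)
qed

end
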